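(* Let $p>2$ and $\acute{p}>2$ with $\acute{p}>\frac{2p}{p-2}$. Then, $\mathbb{P}$-almost surely, the $p$-variation norm frame process $\mathcal{S}^{B,p}:[0,1]\to (C([0,1])_p,\|\cdot\|_p)$ has finite $\acute{p}$-variation. Furthermore, $\mathbb{P}$-almost surely, the dyadic polygonal approximations $\mathcal{S}^{B,p}(m)$ converge to $\mathcal{S}^{B,p}$ in $\acute{p}$-variation as $m\to\infty$.
   Context: $C_0([-1,1])$ is the space of continuous $f:[-1,1]\to\mathbb{R}$ with $f(-1)=0$, with the sup-norm, equipped with the $\mathbb{P}$-completed Borel $\sigma$-algebra, where $\mathbb{P}$ is Wiener measure (under which the coordinate process $B_t(f)=f(t)$, $t\in[-1,1]$, is a Brownian motion started from $0$ at time $-1$). For a path $x:[a,b]\to V$ in a Banach space $V$ and $q\ge1$, $\mathcal{V}_q(x):=\sup_D\big(\sum_{D}|x_{t_{i+1}}-x_{t_i}|_V^q\big)^{1/q}$, the supremum over all finite dissections $D=\{a=t_0<\dots<t_n=b\}$; $x$ has finite $q$-variation if $\mathcal{V}_q(x)<\infty$, and $x(m)\to x$ in $q$-variation if $\mathcal{V}_q(x(m)-x)\to0$. $C([a,b])_p$ is the space of continuous $f:[a,b]\to\mathbb{R}$ with $\mathcal{V}_p(f)<\infty$, $C_0([a,b])_p$ the subspace of those vanishing at $a$; $\|f\|_p:=\mathcal{V}_p(f)+\|f\|_\infty$. For $h\in[0,1]$, $\mathcal{T}^f_h(u):=f(h-1+u)$, $u\in[0,1]$. For $p>2$, $\mathcal{T}^{B,p}_h(f):=\mathcal{T}^f_h$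 if $f\in C_0([-1,1])_p$ (a set of full $\mathbb{P}$-measure) and $0$ otherwise. $\mathcal{S}^{B,p}$ denotes the continuous modification of the process $(\mathcal{T}^{B,p}_h)_{h\in[0,1]}$ with values in $(C([0,1])_p,\|\cdot\|_p)$. The $m$-th dyadic polygonal approximation of a $V$-valued path $X$ on $[0,1]$ is $X(m)_t:=X_{\frac{k-1}{2^m}}+2^m\big(t-\frac{k-1}{2^m}\big)\big(X_{\frac{k}{2^m}}-X_{\frac{k-1}{2^m}}\big)$ for $\frac{k-1}{2^m}\le t\le\frac{k}{2^m}$, $1\le k\le 2^m$. *)

theory Defs
  imports "HOL-Probability.Probability"
begin

text \<open>
  Functions on an interval \<open>[a,b]\<close> are represented by functions of type \<open>real \<Rightarrow> real\<close> that are
  \<open>extensional\<close> on \<open>{a..b}\<close>, so that equality of representatives is equality on \<open>[a,b]\<close>.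
  All norms below only depend on the values on \<open>[a,b]\<close>; the pointwise difference of two
  representatives is therefore used as is, although it is \<open>0\<close> instead of \<open>undefined\<close> outside.
\<close>

definition dissections :: "real \<Rightarrow> real \<Rightarrow> (nat \<times> (nat \<Rightarrow> real)) set" where
  "dissections a b = {(n, t). t 0 = a \<and> t n = b \<and> (\<forall>i<n. t i < t (Suc i))}"

text \<open>The first argument is the norm of the space in which the path takes its values.\<close>

definition variation ::
    "('v::minus \<Rightarrow> real) \<Rightarrow> real \<Rightarrow> real \<Rightarrow> real \<Rightarrow> (real \<Rightarrow> 'v) \<Rightarrow> ennreal" where
  "variation N q a b x =
     (SUP (n, t)\<in>dissections a b.
        ennreal ((\<Sum>i<n. N (x (t (Suc i)) - x (t i)) powr q) powr (1 / q)))"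

definition cont_paths :: "real \<Rightarrow> real \<Rightarrow> (real \<Rightarrow> real) set" where
  "cont_paths a b = {f \<in> extensional {a..b}. continuous_on {a..b} f}"

definition cont_paths0 :: "real \<Rightarrow> real \<Rightarrow> (real \<Rightarrow> real) set" where
  "cont_paths0 a b = {f \<in> cont_paths a b. f a = 0}"

definition sup_norm :: "real \<Rightarrow> real \<Rightarrow> (real \<Rightarrow> real) \<Rightarrow> real" where
  "sup_norm a b f = (SUP u\<in>{a..b}. \<bar>f u\<bar>)"

definition cont_var_paths :: "real \<Rightarrow> real \<Rightarrow> real \<Rightarrow> (real \<Rightarrow> real) set" where
  "cont_var_paths p a b = {f \<in> cont_paths a b. variation abs p a b f < \<infinity>}"

definition cont_var_paths0 :: "real \<Rightarrow> real \<Rightarrow> real \<Rightarrow> (real \<Rightarrow> real) set" where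
  "cont_var_paths0 p a b = {f \<in> cont_var_paths p a b. f a = 0}"

text \<open>Only meaningful for functions of finite \<open>p\<close>-variation, since \<open>enn2real \<infinity> = 0\<close>.\<close>

definition var_norm :: "real \<Rightarrow> real \<Rightarrow> real \<Rightarrow> (real \<Rightarrow> real) \<Rightarrow> real" where
  "var_norm p a b f = enn2real (variation abs p a b f) + sup_norm a b f"

text \<open>The Borel \<open>\<sigma>\<close>-algebra of the sup-norm topology (as a measure space, with the zero measure).\<close>

definition borel_cont_paths0 :: "real \<Rightarrow> real \<Rightarrow> (real \<Rightarrow> real) measure" where
  "borel_cont_paths0 a b =
     sigma (cont_paths0 a b)
       {U. U \<subseteq> cont_paths0 a b \<and>
           (\<forall>f\<in>U. \<exists>e>0. \<forall>g\<in>cont_paths0 a b. sup_norm a b (g - f) < e \<longrightarrow> g \<in> U)}"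

definition brownian_motion_on ::
    "'w measure \<Rightarrow> real \<Rightarrow> real \<Rightarrow> (real \<Rightarrow> 'w \<Rightarrow> real) \<Rightarrow> bool" where
  "brownian_motion_on M a b B \<longleftrightarrow>
     prob_space M \<and>
     (\<forall>t\<in>{a..b}. B t \<in> borel_measurable M) \<and>
     (\<forall>\<omega>\<in>space M. B a \<omega> = 0 \<and> continuous_on {a..b} (\<lambda>t. B t \<omega>)) \<and>
     (\<forall>s t. a \<le> s \<and> s < t \<and> t \<le> b \<longrightarrow>
        distributed M lborel (\<lambda>\<omega>. B t \<omega> - B s \<omega>) (normal_density 0 (sqrt (t - s)))) \<and>
     (\<forall>(n, t)\<in>dissections a b.
        prob_space.indep_vars M (\<lambda>_. borel) (\<lambda>i \<omega>. B (t (Suc i)) \<omega> - B (t i) \<omega>) {..<n})"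

text \<open>The measure lives on the uncompleted Borel \<open>\<sigma>\<close>-algebra; apply \<open>completion\<close> to complete it.\<close>

definition wiener_measure :: "real \<Rightarrow> real \<Rightarrow> (real \<Rightarrow> real) measure \<Rightarrow> bool" where
  "wiener_measure a b W \<longleftrightarrow>
     sets W = sets (borel_cont_paths0 a b) \<and> brownian_motion_on W a b (\<lambda>t f. f t)"

definition frame :: "real \<Rightarrow> (real \<Rightarrow> real) \<Rightarrow> real \<Rightarrow> real" where
  "frame h f = (\<lambda>u\<in>{0..1}. f (h - 1 + u))"

definition brownian_frame :: "real \<Rightarrow> real \<Rightarrow> (real \<Rightarrow> real) \<Rightarrow> real \<Rightarrow> real" where
  "brownian_frame p h f =
     (if f \<in> cont_var_paths0 p (-1) 1 then frame h f else (\<lambda>u\<in>{0..1}. 0))"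

text \<open>
  \<open>S\<close> is a modification on \<open>M\<close> of the process \<open>T\<close>, indexed by \<open>[0,1]\<close>, all of whose paths are continuous
  with values in the \<open>p\<close>-variation space over \<open>[0,1]\<close>. Measurability of \<open>S h\<close> is not
  required separately: on a complete space it is inherited from \<open>T h\<close>.
\<close>

definition continuous_modification ::
    "real \<Rightarrow> 'w measure \<Rightarrow> (real \<Rightarrow> 'w \<Rightarrow> real \<Rightarrow> real) \<Rightarrow> (real \<Rightarrow> 'w \<Rightarrow> real \<Rightarrow> real) \<Rightarrow> bool" where
  "continuous_modification p M T S \<longleftrightarrow>
     (\<forall>h\<in>{0..1}. AE \<omega> in M. S h \<omega> = T h \<omega>) \<and>
     (\<forall>\<omega>\<in>space M. \<forall>h\<in>{0..1}. S h \<omega> \<in> cont_var_paths p 0 1) \<and>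
     (\<forall>\<omega>\<in>space M. \<forall>h\<in>{0..1}.
        ((\<lambda>k. var_norm p 0 1 (S k \<omega> - S h \<omega>)) \<longlongrightarrow> 0) (at h within {0..1}))"

text \<open>
  For \<open>t\<close> in \<open>[0,1]\<close> the index \<open>k\<close> satisfies \<open>1 \<le> k \<le> 2 ^ m\<close> and \<open>(k - 1) / 2 ^ m \<le> t \<le> k / 2 ^ m\<close>;
  the vector space operations are pointwise.
\<close>

definition dyadic_polygon :: "nat \<Rightarrow> (real \<Rightarrow> 'a \<Rightarrow> real) \<Rightarrow> real \<Rightarrow> 'a \<Rightarrow> real" where
  "dyadic_polygon m X t =
     (let k = of_int (max 1 \<lceil>2 ^ m * t\<rceil>);
          l = (k - 1) / 2 ^ m;
          r = k / 2 ^ m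
      in (\<lambda>u. X l u + 2 ^ m * (t - l) * (X r u - X l u)))"

lemma dyadic_polygon_eq:
  fixes k :: nat
  assumes k: "1 \<le> k" and lower: "(real k - 1) / 2 ^ m \<le> t" and upper: "t \<le> real k / 2 ^ m"
  shows "dyadic_polygon m X t u =
    X ((real k - 1) / 2 ^ m) u +
      2 ^ m * (t - (real k - 1) / 2 ^ m) * (X (real k / 2 ^ m) u - X ((real k - 1) / 2 ^ m) u)"
proof (cases "t = (real k - 1) / 2 ^ m")
  case False
  then have "real k - 1 < 2 ^ m * t" and "2 ^ m * t \<le> real k"
    using lower upper by (auto simp: field_simps)
  then have "\<lceil>2 ^ m * t\<rceil> = int k"
    by (intro ceiling_unique) auto
  then show ?thesis
    using k by (simp add: dyadic_polygon_def Let_def max_def)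
next
  case True
  then have t: "2 ^ m * t = real_of_int (int k - 1)"
    using k by simp
  have "\<lceil>2 ^ m * t\<rceil> = int k - 1"
    unfolding t by (rule ceiling_of_int)
  show ?thesis
  proof (cases "k = 1")
    case False
    then have max_eq: "max 1 (int k - 1) = int k - 1"
      using k by simp
    have "2 ^ m * (t - (real k - 1 - 1) / 2 ^ m) = 1"
      using t by (simp add: right_diff_distrib del: of_int_diff) (simp add: field_simps)
    then show ?thesis
      using True \<open>\<lceil>2 ^ m * t\<rceil> = int k - 1\<close> by (simp add: dyadic_polygon_def Let_def max_eq)
  qed (use True in \<open>simp add: dyadic_polygon_def Let_def\<close>)
qed

end

theory Submission
  imports Defs
begin

text \<open>
  Almost every Brownian path \<open>f\<close> is \<open>\<alpha>\<close>-Hoelder for every \<open>\<alpha> < 1/2\<close>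
  (\<open>brownian_motion_on_holder\<close>). Hence the two-parameter function \<open>X h u = f (h - 1 + u)\<close>, that is the
  frame process evaluated at \<open>u\<close>, is \<open>\<alpha>\<close>-Hoelder in each of its variables, and the variation estimates are
  deterministic statements about such functions (\<open>variation_var_norm_holder_sheet\<close>).

  The difference \<open>g = X h - X k\<close> satisfies two bounds of order \<open>\<bar>h - k\<bar> powr \<alpha>\<close> and
  \<open>\<bar>u - v\<bar> powr \<alpha>\<close> on its increments \<open>g u - g v\<close>. In the sum of the \<open>p\<close>-th powers of these increments,
  the share \<open>1 / p\<close> of the exponent \<open>\<alpha>\<close> is spent on \<open>\<bar>u - v\<bar>\<close>, which telescopes, and the remainder
  on \<open>\<bar>h - k\<bar>\<close>. So the frame process is Hoelder of exponent \<open>\<alpha> - 1 / p\<close> in the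
  \<open>p\<close>-variation norm. Such a path has finite \<open>q\<close>-variation as soon as \<open>(\<alpha> - 1 / p) q \<ge> 1\<close>. The
  hypothesis \<open>q > 2 p / (p - 2)\<close> says \<open>1 / p + 1 / q < 1 / 2\<close>, which leaves room for an
  \<open>\<alpha> < 1/2\<close> with \<open>\<alpha> > 1 / p + 1 / q\<close>.

  For the dyadic polygons the same computation is applied to the error \<open>D = X(m) - X\<close>: its
  increments in \<open>h\<close> are bounded by a multiple of \<open>\<bar>h - k\<bar> powr \<alpha>\<close> and, since the polygon is uniformly
  close to \<open>X\<close>, also by a multiple of \<open>((1 / 2) ^ m) powr \<alpha>\<close>. The strict inequality for \<open>\<alpha>\<close> leaves a
  positive power of \<open>(1 / 2) ^ m\<close> over, and the error tends to \<open>0\<close> in \<open>q\<close>-variation.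

  All estimates are made on pointwise increments before any norm is taken, because pointwise Hoelder
  bounds add up and pass to convex combinations directly.

  Finally, a continuous modification of the frame process agrees almost surely with the frame
  process at all times simultaneously (\<open>continuous_modification_eq_frame\<close>).
\<close>

section \<open>Hoelder continuity of Brownian paths\<close>

lemma half_power_powr: "((1 / 2) ^ m) powr \<alpha> = ((1 / 2 :: real) powr \<alpha>) ^ m"
  by (simp add: powr_powr powr_realpow[symmetric] mult.commute)

lemma dyadic_scale:
  fixes d :: real
  assumes "0 < d" "d \<le> 1"
  obtains m where "(1 / 2) ^ Suc m < d" "d \<le> (1 / 2) ^ m"
proof -
  have ex: "\<exists>n. (1 / 2 :: real) ^ n < d"
    using assms(1) by (intro real_arch_pow_inv) auto
  define n where "n = (LEAST n. (1 / 2 :: real) ^ n < d)"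
  have n: "(1 / 2 :: real) ^ n < d"
    unfolding n_def by (rule LeastI_ex[OF ex])
  have "n \<noteq> 0"
    using n assms(2) by (intro notI) simp
  then obtain m where m: "n = Suc m"
    by (cases n) auto
  have "\<not> (1 / 2 :: real) ^ m < d"
    using not_less_Least[of m "\<lambda>n. (1 / 2 :: real) ^ n < d"] m unfolding n_def by simp
  then show ?thesis
    using that n m by auto
qed

text \<open>
  Chaining: \<open>x\<close> is approximated by its dyadic truncations \<open>P m x\<close>. Consecutive truncations are
  equal or neighbours on the finer grid, so \<open>\<bar>f x - f (P m x)\<bar>\<close> is bounded by a geometric tail. Two
  points at distance about \<open>(1 / 2) ^ m\<close> have equal or neighbouring truncations at level \<open>m\<close>.
\<close>

lemma holder_if_dyadic_increments_le:
  fixes f :: "real \<Rightarrow> real"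
  assumes cont: "continuous_on {0..1} f" and \<alpha>: "0 < \<alpha>" and K: "0 \<le> K"
    and incr: "\<And>m i. i < 2 ^ m \<Longrightarrow>
      \<bar>f (real (Suc i) / 2 ^ m) - f (real i / 2 ^ m)\<bar> \<le> K * ((1 / 2) ^ m) powr \<alpha>"
  shows "\<exists>C\<ge>0. \<forall>s\<in>{0..1}. \<forall>t\<in>{0..1}. \<bar>f s - f t\<bar> \<le> C * \<bar>s - t\<bar> powr \<alpha>"
proof -
  define \<rho> where "\<rho> = (1 / 2 :: real) powr \<alpha>"
  have \<rho>0: "0 < \<rho>"
    unfolding \<rho>_def by simp
  have \<rho>1: "\<rho> < 1"
    using powr_less_mono2[of \<alpha> "1/2" 1] \<alpha> unfolding \<rho>_def by simp
  have incr: "\<bar>f (real (Suc i) / 2 ^ m) - f (real i / 2 ^ m)\<bar> \<le> K * \<rho> ^ m" if "i < 2 ^ m" for m i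
    using incr[OF that] unfolding half_power_powr \<rho>_def .
  define j where "j m x = nat \<lfloor>2 ^ m * x\<rfloor>" for m and x :: real
  define P where "P m x = real (j m x) / 2 ^ m" for m x
  have j: "real (j m x) \<le> 2 ^ m * x" "2 ^ m * x < real (j m x) + 1" if "0 \<le> x" for m x
    using that unfolding j_def by (simp_all add: of_nat_nat)
  have j_le: "j m x \<le> 2 ^ m" if "x \<in> {0..1}" for m x
  proof -
    have "real (j m x) \<le> 2 ^ m * 1"
      by (rule order_trans[OF j(1) mult_left_mono]) (use that in auto)
    then show ?thesis
      by simp
  qed
  have step: "\<bar>f (P (Suc m) x) - f (P m x)\<bar> \<le> K * \<rho> ^ Suc m" if x: "x \<in> {0..1}" for m x
  proof -
    have "real (2 * j m x) < real (j (Suc m) x + 1)" "real (j (Suc m) x) < real (2 * j m x + 2)"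
      using j[of x m] j[of x "Suc m"] x by (auto simp: algebra_simps)
    then have "j (Suc m) x = 2 * j m x \<or> j (Suc m) x = Suc (2 * j m x)"
      unfolding of_nat_less_iff by linarith
    then show ?thesis
    proof
      assume "j (Suc m) x = 2 * j m x"
      then show ?thesis
        using K \<rho>0 by (simp add: P_def)
    next
      assume *: "j (Suc m) x = Suc (2 * j m x)"
      have "P m x = real (2 * j m x) / 2 ^ Suc m"
        by (simp add: P_def)
      moreover have "2 * j m x < 2 ^ Suc m"
        using j_le[OF x, of "Suc m"] * by simp
      ultimately show ?thesis
        using incr[of "2 * j m x" "Suc m"] * by (simp add: P_def)
    qed
  qed
  \<comment> \<open>\<open>G * \<rho> ^ m\<close> is the tail \<open>K * (\<rho> ^ (m + 1) + \<rho> ^ (m + 2) + \<dots>)\<close>.\<close>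
  define G where "G = K * (\<rho> / (1 - \<rho>))"
  have G0: "0 \<le> G"
    unfolding G_def using K \<rho>0 \<rho>1 by auto
  have tele: "\<bar>f (P (m + n) x) - f (P m x)\<bar> \<le> G * (\<rho> ^ m - \<rho> ^ (m + n))" if x: "x \<in> {0..1}" for m n x
  proof (induction n)
    case (Suc n)
    have "G * (\<rho> ^ (m + n) - \<rho> ^ Suc (m + n)) = K * \<rho> ^ Suc (m + n)"
      unfolding G_def using \<rho>1 by (simp add: field_simps)
    then show ?case
      using Suc step[OF x, of "m + n"] by (simp add: algebra_simps)
  qed simp
  have approx: "\<bar>f x - f (P m x)\<bar> \<le> G * \<rho> ^ m" if x: "x \<in> {0..1}" for m x
  proof -
    have P_le: "P n x \<le> x" "x \<le> P n x + (1 / 2) ^ n" for n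
      using j[of x n] x by (auto simp: P_def field_simps)
    have P_in: "P n x \<in> {0..1}" for n
      using order_trans[OF P_le(1)[of n], of 1] x unfolding atLeastAtMost_iff by (simp add: P_def)
    have "(\<lambda>n. (1 / 2 :: real) ^ n) \<longlonglongrightarrow> 0"
      by (rule LIMSEQ_power_zero) simp
    then have "(\<lambda>n. x - (1 / 2) ^ n) \<longlonglongrightarrow> x - 0"
      by (rule tendsto_diff[OF tendsto_const])
    then have lower: "(\<lambda>n. x - (1 / 2) ^ n) \<longlonglongrightarrow> x"
      by simp
    have "x - (1 / 2) ^ n \<le> P n x" for n
      using P_le(2)[of n] by linarith
    then have "(\<lambda>n. P n x) \<longlonglongrightarrow> x"
      using P_le(1) by (intro tendsto_sandwich[OF _ _ lower tendsto_const] always_eventually allI)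
    then have "(\<lambda>n. P (n + m) x) \<longlonglongrightarrow> x"
      by (rule LIMSEQ_ignore_initial_segment)
    then have "(\<lambda>n. f (P (n + m) x)) \<longlonglongrightarrow> f x"
      by (rule continuous_on_tendsto_compose[OF cont _ x always_eventually]) (intro allI P_in)
    then have "(\<lambda>n. \<bar>f (P (n + m) x) - f (P m x)\<bar>) \<longlonglongrightarrow> \<bar>f x - f (P m x)\<bar>"
      by (intro tendsto_rabs tendsto_diff tendsto_const)
    moreover have "\<bar>f (P (n + m) x) - f (P m x)\<bar> \<le> G * \<rho> ^ m" for n
    proof -
      have "0 \<le> G * \<rho> ^ (m + n)"
        using G0 \<rho>0 by simp
      then show ?thesis
        using tele[OF x, of m n] unfolding right_diff_distrib add.commute[of n m] by linarith
    qed
    ultimately show ?thesis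
      by (blast intro: LIMSEQ_le_const2)
  qed
  define C where "C = (K + 2 * G) / \<rho>"
  have C0: "0 \<le> C"
    using K G0 \<rho>0 by (simp add: C_def)
  have main: "\<bar>f s - f t\<bar> \<le> C * (t - s) powr \<alpha>" if s: "s \<in> {0..1}" and t: "t \<in> {0..1}" and "s < t" for s t
  proof -
    obtain m where m: "(1 / 2) ^ Suc m < t - s" "t - s \<le> (1 / 2) ^ m"
      using dyadic_scale[of "t - s"] s t \<open>s < t\<close> by auto
    have "2 ^ m * (t - s) \<le> 1"
      using m(2) by (simp add: field_simps)
    then have "2 ^ m * t \<le> 2 ^ m * s + 1"
      by (simp add: algebra_simps)
    moreover have "2 ^ m * s < 2 ^ m * t"
      using \<open>s < t\<close> by simp
    moreover have "0 \<le> s" "0 \<le> t"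
      using s t by auto
    ultimately have "real (j m s) < real (j m t + 1)" "real (j m t) < real (j m s + 2)"
      using j[of s m] j[of t m] by linarith+
    then have "j m t = j m s \<or> j m t = Suc (j m s)"
      unfolding of_nat_less_iff by linarith
    then have "\<bar>f (P m t) - f (P m s)\<bar> \<le> K * \<rho> ^ m"
      using incr[of "j m s" m] j_le[OF t, of m] K \<rho>0 by (auto simp: P_def)
    then have "\<bar>f s - f t\<bar> \<le> (K + 2 * G) * \<rho> ^ m"
      using approx[OF s, of m] approx[OF t, of m] by (simp add: algebra_simps)
    also have "\<dots> = C * \<rho> ^ Suc m"
      using \<rho>0 by (simp add: C_def)
    also have "\<rho> ^ Suc m \<le> (t - s) powr \<alpha>"
      unfolding \<rho>_def half_power_powr[symmetric] using m(1) \<alpha> by (intro powr_mono2) auto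
    finally show ?thesis
      using C0 by (simp add: mult_left_mono)
  qed
  have "\<bar>f s - f t\<bar> \<le> C * \<bar>s - t\<bar> powr \<alpha>" if "s \<in> {0..1}" "t \<in> {0..1}" for s t
    using main[of s t] main[of t s] that by (cases s t rule: linorder_cases) (auto simp: abs_minus_commute)
  then show ?thesis
    using C0 by blast
qed

text \<open>
  The Kolmogorov--Chentsov criterion for a process that is already continuous. The sum \<open>Z\<close> over all levels
  of the suitably rescaled \<open>r\<close>-th powers of the dyadic increments has finite expectation, because the
  \<open>2 ^ m\<close> increments of level \<open>m\<close> contribute a geometric term of ratio \<open>2 powr (\<alpha> * r - \<beta>) < 1\<close>.
  So \<open>Z\<close> is almost surely finite, and it dominates each single dyadic increment.
\<close>

theorem kolmogorov_chentsov_interval: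
  fixes B :: "real \<Rightarrow> 'w \<Rightarrow> real"
  assumes "a < b" and "0 < r" and \<alpha>: "0 < \<alpha>" "\<alpha> * r < \<beta>"
    and meas: "\<And>t. t \<in> {a..b} \<Longrightarrow> B t \<in> borel_measurable M"
    and cont: "\<And>\<omega>. \<omega> \<in> space M \<Longrightarrow> continuous_on {a..b} (\<lambda>t. B t \<omega>)"
    and moment: "\<And>s t. a \<le> s \<Longrightarrow> s < t \<Longrightarrow> t \<le> b \<Longrightarrow>
      (\<integral>\<^sup>+\<omega>. ennreal (\<bar>B t \<omega> - B s \<omega>\<bar> powr r) \<partial>M) \<le> ennreal (c * (t - s) powr (1 + \<beta>))"
  shows "AE \<omega> in M. \<exists>C\<ge>0. \<forall>s\<in>{a..b}. \<forall>t\<in>{a..b}. \<bar>B s \<omega> - B t \<omega>\<bar> \<le> C * \<bar>s - t\<bar> powr \<alpha>"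
proof -
  define x where "x m i = a + (b - a) * (real i / 2 ^ m)" for m i :: nat
  have x_in: "x m i \<in> {a..b}" if "i \<le> 2 ^ m" for m i
  proof -
    have "real i \<le> 2 ^ m"
      using that by simp
    then have "(b - a) * (real i / 2 ^ m) \<le> (b - a) * 1"
      using \<open>a < b\<close> by (intro mult_left_mono) auto
    then show ?thesis
      using \<open>a < b\<close> by (auto simp: x_def)
  qed
  define Y where "Y m i \<omega> = ((2 powr \<alpha>) ^ m * \<bar>B (x m (Suc i)) \<omega> - B (x m i) \<omega>\<bar>) powr r" for m i \<omega>
  define Z where "Z \<omega> = (\<Sum>m. \<Sum>i<2 ^ m. ennreal (Y m i \<omega>))" for \<omega>
  have I_meas: "(\<lambda>\<omega>. \<bar>B (x m (Suc i)) \<omega> - B (x m i) \<omega>\<bar>) \<in> borel_measurable M" if "i < 2 ^ m" for m i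
    using that by (intro borel_measurable_abs borel_measurable_diff meas x_in) auto
  have Y_meas: "Y m i \<in> borel_measurable M" if "i < 2 ^ m" for m i
    unfolding Y_def using I_meas[OF that] by (intro powr_real_measurable borel_measurable_times) auto
  have Z_meas: "Z \<in> borel_measurable M"
    unfolding Z_def using Y_meas
    by (intro borel_measurable_suminf_order borel_measurable_sum measurable_compose[OF _ measurable_ennreal]) auto
  define D where "D = \<bar>c\<bar> * (b - a) powr (1 + \<beta>)"
  define \<theta> where "\<theta> = 2 powr (\<alpha> * r - \<beta>)"
  have \<theta>: "0 < \<theta>" "\<theta> < 1"
    using \<alpha> powr_less_mono[of "\<alpha> * r - \<beta>" 0 2] by (auto simp: \<theta>_def)
  have Y_int: "(\<integral>\<^sup>+\<omega>. ennreal (Y m i \<omega>) \<partial>M) \<le> ennreal (D * (\<theta> / 2) ^ m)" if i: "i < 2 ^ m" for m i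
  proof -
    let ?I = "\<lambda>\<omega>. \<bar>B (x m (Suc i)) \<omega> - B (x m i) \<omega>\<bar>"
    have d: "x m (Suc i) - x m i = (b - a) * (1 / 2) ^ m"
      by (simp add: x_def field_simps)
    have d0: "x m i < x m (Suc i)"
    proof -
      have "0 < (b - a) * (1 / 2) ^ m"
        using \<open>a < b\<close> by simp
      then show ?thesis
        using d by linarith
    qed
    have "(\<integral>\<^sup>+\<omega>. ennreal (Y m i \<omega>) \<partial>M)
        = (\<integral>\<^sup>+\<omega>. ennreal (((2 powr \<alpha>) ^ m) powr r) * ennreal (?I \<omega> powr r) \<partial>M)"
      by (simp add: Y_def powr_mult ennreal_mult)
    also have "\<dots> = ennreal (((2 powr \<alpha>) ^ m) powr r) * (\<integral>\<^sup>+\<omega>. ennreal (?I \<omega> powr r) \<partial>M)"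
      by (intro nn_integral_cmult measurable_compose[OF _ measurable_ennreal] powr_real_measurable I_meas[OF i]) auto
    also have "\<dots> \<le> ennreal (((2 powr \<alpha>) ^ m) powr r)
        * ennreal (\<bar>c\<bar> * ((b - a) * (1 / 2) ^ m) powr (1 + \<beta>))"
      using moment[of "x m i" "x m (Suc i)"] x_in[of i m] x_in[of "Suc i" m] i d0 d
      by (intro mult_left_mono order_trans[OF moment] ennreal_leI mult_right_mono) auto
    also have "\<dots> = ennreal (D * (\<theta> / 2) ^ m)"
    proof -
      have "((2 powr \<alpha>) ^ m) powr r * ((1 / 2) ^ m) powr (1 + \<beta>) = (\<theta> / 2) ^ m"
      proof -
        have "((2 powr \<alpha>) ^ m) powr r = (2 powr (\<alpha> * r)) ^ m"
          by (simp add: powr_realpow[symmetric] powr_powr ac_simps)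
        moreover have "((1 / 2 :: real) ^ m) powr (1 + \<beta>) = (2 powr - (1 + \<beta>)) ^ m"
          unfolding half_power_powr by (simp only: powr_divide powr_minus_divide powr_one_eq_one)
        moreover have "2 powr (\<alpha> * r) * 2 powr - (1 + \<beta>) = \<theta> / 2"
          unfolding \<theta>_def by (simp add: powr_diff powr_minus_divide powr_add)
        ultimately show ?thesis
          by (metis power_mult_distrib)
      qed
      then show ?thesis
        by (simp add: D_def powr_mult ennreal_mult[symmetric] ac_simps)
    qed
    finally show ?thesis .
  qed
  have "(\<integral>\<^sup>+\<omega>. Z \<omega> \<partial>M) = (\<Sum>m. \<Sum>i<2 ^ m. \<integral>\<^sup>+\<omega>. ennreal (Y m i \<omega>) \<partial>M)"
    unfolding Z_def using Y_meas
    by (subst nn_integral_suminf)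
      (auto intro!: borel_measurable_sum measurable_compose[OF _ measurable_ennreal] suminf_cong nn_integral_sum)
  also have "\<dots> \<le> (\<Sum>m. ennreal (D * \<theta> ^ m))"
  proof (intro suminf_le)
    fix m :: nat
    have "(\<Sum>i<2 ^ m. \<integral>\<^sup>+\<omega>. ennreal (Y m i \<omega>) \<partial>M) \<le> (\<Sum>i<(2::nat) ^ m. ennreal (D * (\<theta> / 2) ^ m))"
      by (intro sum_mono Y_int) auto
    also have "\<dots> = ennreal (2 ^ m * (D * (\<theta> / 2) ^ m))"
      using \<theta> by (subst sum_ennreal) (auto simp: D_def)
    finally show "(\<Sum>i<2 ^ m. \<integral>\<^sup>+\<omega>. ennreal (Y m i \<omega>) \<partial>M) \<le> ennreal (D * \<theta> ^ m)"
      by (simp add: field_simps)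
  qed auto
  finally have Z_le: "(\<integral>\<^sup>+\<omega>. Z \<omega> \<partial>M) \<le> (\<Sum>m. ennreal (D * \<theta> ^ m))" .
  have "summable (\<lambda>m. D * \<theta> ^ m)"
    using \<theta> by (intro summable_mult summable_geometric) simp
  moreover have "0 \<le> D * \<theta> ^ m" for m
    using \<theta> by (simp add: D_def)
  ultimately have "(\<Sum>m. ennreal (D * \<theta> ^ m)) \<noteq> top"
    by (rule ennreal_suminf_neq_top)
  then have Z_int: "(\<integral>\<^sup>+\<omega>. Z \<omega> \<partial>M) \<noteq> \<infinity>"
    using Z_le neq_top_trans by fastforce
  have "AE \<omega> in M. Z \<omega> \<noteq> \<infinity>"
    by (rule nn_integral_PInf_AE[OF Z_meas Z_int])
  then show ?thesis
    using AE_space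
  proof (eventually_elim, goal_cases)
    case (1 \<omega>)
    then obtain z where z: "Z \<omega> = ennreal z" "0 \<le> z"
      by (cases "Z \<omega>" rule: ennreal_cases) auto
    define K where "K = z powr (1 / r)"
    have incr: "\<bar>B (x m (Suc i)) \<omega> - B (x m i) \<omega>\<bar> \<le> K * ((1 / 2) ^ m) powr \<alpha>"
      if i: "i < 2 ^ m" for m i
    proof -
      have "ennreal (Y m i \<omega>) \<le> (\<Sum>i<2 ^ m. ennreal (Y m i \<omega>))"
        using i by (intro member_le_sum) auto
      also have "\<dots> \<le> Z \<omega>"
        unfolding Z_def using sum_le_suminf[of "\<lambda>m. \<Sum>i<2 ^ m. ennreal (Y m i \<omega>)" "{m}"] by auto
      finally have "Y m i \<omega> \<le> z"
        using z by simp
      then have "Y m i \<omega> powr (1 / r) \<le> K"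
        unfolding K_def using \<open>0 < r\<close> by (intro powr_mono2) (auto simp: Y_def)
      then have "(2 powr \<alpha>) ^ m * \<bar>B (x m (Suc i)) \<omega> - B (x m i) \<omega>\<bar> \<le> K"
        using \<open>0 < r\<close> by (simp add: Y_def powr_powr)
      then show ?thesis
        unfolding half_power_powr by (simp add: powr_divide power_divide field_simps)
    qed
    have "\<exists>C\<ge>0. \<forall>s\<in>{0..1}. \<forall>t\<in>{0..1}.
        \<bar>B (a + (b - a) * s) \<omega> - B (a + (b - a) * t) \<omega>\<bar> \<le> C * \<bar>s - t\<bar> powr \<alpha>"
    proof (rule holder_if_dyadic_increments_le)
      have "a + (b - a) * u \<in> {a..b}" if "u \<in> {0..1}" for u
      proof -
        have "0 \<le> (b - a) * u" "(b - a) * u \<le> (b - a) * 1"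
          using that \<open>a < b\<close> by (intro mult_left_mono mult_nonneg_nonneg; simp)+
        then show ?thesis
          by simp
      qed
      then show "continuous_on {0..1} (\<lambda>u. B (a + (b - a) * u) \<omega>)"
        by (intro continuous_on_compose2[OF cont[OF 1(2)]] continuous_intros image_subsetI)
      show "\<bar>B (a + (b - a) * (real (Suc i) / 2 ^ m)) \<omega> - B (a + (b - a) * (real i / 2 ^ m)) \<omega>\<bar>
          \<le> K * ((1 / 2) ^ m) powr \<alpha>" if "i < 2 ^ m" for m i
        using incr[OF that] unfolding x_def .
      show "0 \<le> K"
        by (simp add: K_def)
    qed fact
    then obtain C where C: "0 \<le> C" "\<And>s t. s \<in> {0..1} \<Longrightarrow> t \<in> {0..1} \<Longrightarrow>
        \<bar>B (a + (b - a) * s) \<omega> - B (a + (b - a) * t) \<omega>\<bar> \<le> C * \<bar>s - t\<bar> powr \<alpha>"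
      by blast
    have "\<bar>B s \<omega> - B t \<omega>\<bar> \<le> C / (b - a) powr \<alpha> * \<bar>s - t\<bar> powr \<alpha>"
      if "s \<in> {a..b}" "t \<in> {a..b}" for s t
    proof -
      have "\<bar>(s - a) / (b - a) - (t - a) / (b - a)\<bar> = \<bar>s - t\<bar> / (b - a)"
        using \<open>a < b\<close> by (simp add: diff_divide_distrib[symmetric] abs_divide)
      then show ?thesis
        using C(2)[of "(s - a) / (b - a)" "(t - a) / (b - a)"] that \<open>a < b\<close> by (simp add: powr_divide)
    qed
    moreover have "0 \<le> C / (b - a) powr \<alpha>"
      using C(1) by simp
    ultimately show ?case
      by (intro exI[of _ "C / (b - a) powr \<alpha>"] conjI ballI)
  qed
qed

text \<open>
  The constant is \<open>(2 n - 1)!!\<close>, the moment of order \<open>2 n\<close> of the standard normal distribution. The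
  real exponents match the form of the moment condition in the Kolmogorov--Chentsov criterion.
  The case \<open>n = 0\<close> is separate because \<open>0 powr 0 = 0\<close>.
\<close>

lemma brownian_increment_moment:
  assumes BM: "brownian_motion_on M a b B" and st: "a \<le> s" "s < t" "t \<le> b"
  shows "(\<integral>\<^sup>+\<omega>. ennreal (\<bar>B t \<omega> - B s \<omega>\<bar> powr real (2 * n)) \<partial>M)
    \<le> ennreal (fact (2 * n) / (2 ^ n * fact n) * (t - s) powr real n)"
proof (cases "n = 0")
  case True
  interpret prob_space M
    using BM by (simp add: brownian_motion_on_def)
  have "(\<integral>\<^sup>+\<omega>. ennreal (\<bar>B t \<omega> - B s \<omega>\<bar> powr 0) \<partial>M) \<le> (\<integral>\<^sup>+\<omega>. 1 \<partial>M)"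
    by (intro nn_integral_mono) auto
  then show ?thesis
    using True st by (simp add: emeasure_space_1)
next
  case False
  let ?\<phi> = "normal_density 0 (sqrt (t - s))"
  have dist: "distributed M lborel (\<lambda>\<omega>. B t \<omega> - B s \<omega>) ?\<phi>"
    using BM st unfolding brownian_motion_on_def by blast
  have "(\<integral>\<^sup>+\<omega>. ennreal (\<bar>B t \<omega> - B s \<omega>\<bar> powr real (2 * n)) \<partial>M)
      = (\<integral>\<^sup>+\<omega>. ennreal ((B t \<omega> - B s \<omega>) ^ (2 * n)) \<partial>M)"
    using False by (simp add: powr_realpow' power_even_abs del: of_nat_mult)
  also have "\<dots> = (\<integral>\<^sup>+x. ennreal (?\<phi> x) * ennreal (x ^ (2 * n)) \<partial>lborel)"
    by (rule distributed_nn_integral[OF dist, symmetric]) measurable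
  also have "\<dots> = (\<integral>\<^sup>+x. ennreal (?\<phi> x * (x - 0) ^ (2 * n)) \<partial>lborel)"
    by (simp add: ennreal_mult)
  also have "\<dots> = ennreal (fact (2 * n) / ((2 / (sqrt (t - s))\<^sup>2) ^ n * fact n))"
    using normal_moment_even[where \<mu> = 0 and \<sigma> = "sqrt (t - s)" and k = n] st
    unfolding has_bochner_integral_iff by (subst nn_integral_eq_integral) auto
  also have "\<dots> = ennreal (fact (2 * n) / (2 ^ n * fact n) * (t - s) powr real n)"
    using st by (simp add: powr_realpow power_divide)
  finally show ?thesis
    by simp
qed

text \<open>
  Moments of order \<open>2 n\<close> give every exponent below \<open>(n - 1) / (2 n)\<close>, which tends to \<open>1/2\<close>.
\<close>

theorem brownian_motion_on_holder:
  assumes BM: "brownian_motion_on M a b B" and "a < b" and \<alpha>: "0 < \<alpha>" "\<alpha> < 1 / 2"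
  shows "AE \<omega> in M. \<exists>C\<ge>0. \<forall>s\<in>{a..b}. \<forall>t\<in>{a..b}. \<bar>B s \<omega> - B t \<omega>\<bar> \<le> C * \<bar>s - t\<bar> powr \<alpha>"
proof -
  obtain n :: nat where n: "1 / (1 - 2 * \<alpha>) < real n"
    using reals_Archimedean2 by blast
  then have n': "1 < real n * (1 - 2 * \<alpha>)"
    using \<alpha> by (simp add: field_simps)
  then have "n \<noteq> 0"
    by (intro notI) simp
  show ?thesis
  proof (rule kolmogorov_chentsov_interval[where r = "real (2 * n)" and \<beta> = "real n - 1"
        and c = "fact (2 * n) / (2 ^ n * fact n)"])
    show "\<alpha> * real (2 * n) < real n - 1"
      using n' by (simp add: algebra_simps)
    show "0 < real (2 * n)"
      using \<open>n \<noteq> 0\<close> by simp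
    show "(\<integral>\<^sup>+\<omega>. ennreal (\<bar>B t \<omega> - B s \<omega>\<bar> powr real (2 * n)) \<partial>M)
        \<le> ennreal (fact (2 * n) / (2 ^ n * fact n) * (t - s) powr (1 + (real n - 1)))"
      if "a \<le> s" "s < t" "t \<le> b" for s t
      using brownian_increment_moment[OF BM that, of n] by simp
    show "B t \<in> borel_measurable M" if "t \<in> {a..b}" for t
      using BM that unfolding brownian_motion_on_def by blast
    show "continuous_on {a..b} (\<lambda>t. B t \<omega>)" if "\<omega> \<in> space M" for \<omega>
      using BM that unfolding brownian_motion_on_def by blast
  qed fact+
qed

section \<open>Variation of paths with interpolated Hoelder bounds\<close>

lemma dissection_in:
  assumes "(n, t) \<in> dissections a b" "i \<le> n"
  shows "t i \<in> {a..b}"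
proof -
  have step: "t i \<le> t (Suc i)" if "i < n" for i
    using assms(1) that by (auto simp: dissections_def less_imp_le)
  have "t 0 \<le> t i"
    using assms(2) by (induction i) (auto intro: order_trans[OF _ step])
  moreover have "t i \<le> t n"
    using assms(2) by (induction rule: inc_induct) (auto intro: order_trans[OF step])
  ultimately show ?thesis
    using assms(1) by (simp add: dissections_def)
qed

text \<open>
  Of the exponent \<open>\<gamma> q\<close> of \<open>min (t - s) d\<close>, the part \<open>1\<close> is bounded by \<open>t - s\<close>, which telescopes over
  a dissection, and the rest is bounded by \<open>d\<close>. The lemma serves twice: for the
  \<open>p\<close>-variation of real paths, and for the \<open>q\<close>-variation of paths whose values are
  measured by the \<open>p\<close>-variation norm.
\<close>

lemma variation_le_if_holder:
  assumes "0 < q" "1 \<le> \<gamma> * q" "0 < d" "0 \<le> C" "a \<le> b"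
    and nonneg: "\<And>s t. a \<le> s \<Longrightarrow> s < t \<Longrightarrow> t \<le> b \<Longrightarrow> 0 \<le> N (x t - x s)"
    and bound: "\<And>s t. a \<le> s \<Longrightarrow> s < t \<Longrightarrow> t \<le> b \<Longrightarrow> N (x t - x s) \<le> C * min (t - s) d powr \<gamma>"
  shows "variation N q a b x \<le> ennreal (C * d powr (\<gamma> - 1 / q) * (b - a) powr (1 / q))"
  unfolding variation_def
proof (intro SUP_least, clarify intro!: ennreal_leI)
  fix n t
  assume D: "(n, t) \<in> dissections a b"
  let ?L = "C powr q * d powr (\<gamma> * q - 1)"
  have "N (x (t (Suc i)) - x (t i)) powr q \<le> ?L * (t (Suc i) - t i)" if "i < n" for i
  proof -
    have *: "a \<le> t i" "t i < t (Suc i)" "t (Suc i) \<le> b"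
      using dissection_in[OF D, of i] dissection_in[OF D, of "Suc i"] D that
      by (auto simp: dissections_def)
    let ?\<tau> = "min (t (Suc i) - t i) d"
    have "N (x (t (Suc i)) - x (t i)) powr q \<le> (C * ?\<tau> powr \<gamma>) powr q"
      using \<open>0 < q\<close> nonneg[OF *] bound[OF *] by (intro powr_mono2) auto
    also have "\<dots> = C powr q * (?\<tau> powr (\<gamma> * q - 1) * ?\<tau> powr 1)"
      by (simp only: powr_mult powr_powr powr_add[symmetric]) simp
    also have "\<dots> \<le> C powr q * (d powr (\<gamma> * q - 1) * (t (Suc i) - t i))"
      using * assms(2,3) by (intro mult_left_mono mult_mono powr_mono2) auto
    finally show ?thesis
      by (simp add: mult.assoc)
  qed
  then have "(\<Sum>i<n. N (x (t (Suc i)) - x (t i)) powr q) \<le> (\<Sum>i<n. ?L * (t (Suc i) - t i))"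
    by (intro sum_mono) auto
  also have "\<dots> = ?L * (b - a)"
    using D by (simp add: sum_distrib_left[symmetric] sum_lessThan_telescope dissections_def)
  finally have "(\<Sum>i<n. N (x (t (Suc i)) - x (t i)) powr q) powr (1 / q) \<le> (?L * (b - a)) powr (1 / q)"
    using \<open>0 < q\<close> by (intro powr_mono2) (auto intro: sum_nonneg)
  also have "\<dots> = C * d powr (\<gamma> - 1 / q) * (b - a) powr (1 / q)"
    using \<open>0 < q\<close> \<open>0 \<le> C\<close> by (simp add: powr_mult powr_powr diff_divide_distrib)
  finally show "(\<Sum>i<n. N (x (t (Suc i)) - x (t i)) powr q) powr (1 / q)
      \<le> C * d powr (\<gamma> - 1 / q) * (b - a) powr (1 / q)" .
qed

text \<open>
  Nonnegativity needs boundedness, since the supremum of an unbounded set of reals is an arbitrary value.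
\<close>

lemma sup_norm_bounds:
  assumes "a \<le> b" and "\<And>u. u \<in> {a..b} \<Longrightarrow> \<bar>g u\<bar> \<le> K"
  shows "0 \<le> sup_norm a b g" "sup_norm a b g \<le> K"
proof -
  have "bdd_above ((\<lambda>u. \<bar>g u\<bar>) ` {a..b})"
    using assms(2) by (intro bdd_aboveI2)
  then have "\<bar>g a\<bar> \<le> sup_norm a b g"
    unfolding sup_norm_def using assms(1) by (intro cSUP_upper) auto
  then show "0 \<le> sup_norm a b g"
    using abs_ge_zero[of "g a"] by linarith
  show "sup_norm a b g \<le> K"
    unfolding sup_norm_def using assms by (intro cSUP_least) auto
qed

lemma var_norm_bounds:
  assumes "1 \<le> \<alpha> * p" "0 < p" "0 < d" "d \<le> 1" "0 \<le> C"
    and sup: "\<And>u. u \<in> {0..1} \<Longrightarrow> \<bar>g u\<bar> \<le> C * d powr \<alpha>"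
    and holder: "\<And>u v. u \<in> {0..1} \<Longrightarrow> v \<in> {0..1} \<Longrightarrow> \<bar>g u - g v\<bar> \<le> C * \<bar>u - v\<bar> powr \<alpha>"
  shows "0 \<le> var_norm p 0 1 g" "var_norm p 0 1 g \<le> 3 * C * d powr (\<alpha> - 1 / p)"
proof -
  show "0 \<le> var_norm p 0 1 g"
    unfolding var_norm_def using sup_norm_bounds(1)[of 0 1 g, OF _ sup] by auto
  have "variation abs p 0 1 g \<le> ennreal (2 * C * d powr (\<alpha> - 1 / p) * (1 - 0) powr (1 / p))"
  proof (intro variation_le_if_holder)
    fix s t :: real
    assume st: "0 \<le> s" "s < t" "t \<le> 1"
    show "\<bar>g t - g s\<bar> \<le> 2 * C * min (t - s) d powr \<alpha>"
      using sup[of s] sup[of t] holder[of t s] st \<open>0 \<le> C\<close> mult_nonneg_nonneg[of C "(t - s) powr \<alpha>"]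
      by (auto simp: min_def)
  qed (use assms in auto)
  then have "enn2real (variation abs p 0 1 g) \<le> 2 * C * d powr (\<alpha> - 1 / p)"
    using \<open>0 \<le> C\<close> by (intro enn2real_leI) auto
  moreover have "sup_norm 0 1 g \<le> C * d powr \<alpha>"
    using sup by (intro sup_norm_bounds) auto
  moreover have "C * d powr \<alpha> \<le> C * d powr (\<alpha> - 1 / p)"
    using assms(2-5) by (intro mult_left_mono powr_mono') auto
  ultimately show "var_norm p 0 1 g \<le> 3 * C * d powr (\<alpha> - 1 / p)"
    unfolding var_norm_def by linarith
qed

text \<open>
  Both claims of the final theorem come from this bound: finiteness with \<open>\<delta> = 1\<close>, the diameter of
  the index interval, and convergence with \<open>\<delta> = (1 / 2) ^ m\<close>, the mesh of the polygon.
\<close>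

theorem variation_var_norm_le:
  fixes D :: "real \<Rightarrow> real \<Rightarrow> real"
  assumes "0 < p" "0 < q" "1 \<le> \<alpha> * p" "1 \<le> (\<alpha> - 1 / p) * q" "0 < \<delta>" "\<delta> \<le> 1" "0 \<le> C"
    and increment: "\<And>h k u. h \<in> {0..1} \<Longrightarrow> k \<in> {0..1} \<Longrightarrow> u \<in> {0..1} \<Longrightarrow>
      \<bar>D h u - D k u\<bar> \<le> C * min \<bar>h - k\<bar> \<delta> powr \<alpha>"
    and holder: "\<And>h k u v. h \<in> {0..1} \<Longrightarrow> k \<in> {0..1} \<Longrightarrow> u \<in> {0..1} \<Longrightarrow> v \<in> {0..1} \<Longrightarrow>
      \<bar>(D h u - D k u) - (D h v - D k v)\<bar> \<le> C * \<bar>u - v\<bar> powr \<alpha>"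
  shows "variation (var_norm p 0 1) q 0 1 D \<le> ennreal (3 * C * \<delta> powr (\<alpha> - 1 / p - 1 / q))"
proof -
  have norm: "0 \<le> var_norm p 0 1 (D t - D s)"
    "var_norm p 0 1 (D t - D s) \<le> 3 * C * min (t - s) \<delta> powr (\<alpha> - 1 / p)"
    if st: "0 \<le> s" "s < t" "t \<le> 1" for s t
  proof -
    have sup: "\<bar>(D t - D s) u\<bar> \<le> C * min (t - s) \<delta> powr \<alpha>" if "u \<in> {0..1}" for u
      using increment[of t s u] st that by simp
    have hol: "\<bar>(D t - D s) u - (D t - D s) v\<bar> \<le> C * \<bar>u - v\<bar> powr \<alpha>"
      if "u \<in> {0..1}" "v \<in> {0..1}" for u v
      using holder[of t s u v] st that by simp
    have min: "0 < min (t - s) \<delta>" "min (t - s) \<delta> \<le> 1"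
      using assms(5,6) st by auto
    show "0 \<le> var_norm p 0 1 (D t - D s)"
      by (rule var_norm_bounds(1)[OF assms(3,1) min assms(7)]) (rule sup hol; assumption)+
    show "var_norm p 0 1 (D t - D s) \<le> 3 * C * min (t - s) \<delta> powr (\<alpha> - 1 / p)"
      by (rule var_norm_bounds(2)[OF assms(3,1) min assms(7)]) (rule sup hol; assumption)+
  qed
  have "variation (var_norm p 0 1) q 0 1 D
      \<le> ennreal (3 * C * \<delta> powr (\<alpha> - 1 / p - 1 / q) * (1 - 0) powr (1 / q))"
  proof (rule variation_le_if_holder)
    show "0 \<le> 3 * C" "(0 :: real) \<le> 1"
      using assms(7) by simp_all
  qed (fact assms norm)+
  then show ?thesis
    by simp
qed

section \<open>Dyadic polygons of Hoelder paths\<close>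

lemma dyadic_cell:
  fixes h :: real
  assumes "h \<in> {0..1}"
  obtains k :: nat where "1 \<le> k" "k \<le> 2 ^ m" "(real k - 1) / 2 ^ m \<le> h" "h \<le> real k / 2 ^ m"
proof -
  define k where "k = nat (max 1 \<lceil>2 ^ m * h\<rceil>)"
  have k: "real k = real_of_int (max 1 \<lceil>2 ^ m * h\<rceil>)"
    unfolding k_def by simp
  have "2 ^ m * h \<le> 2 ^ m"
    using assms by simp
  then have c: "\<lceil>2 ^ m * h\<rceil> \<le> 2 ^ m"
    by (simp add: ceiling_le_iff)
  then have "max 1 \<lceil>2 ^ m * h\<rceil> \<le> 2 ^ m"
    by simp
  then have "real k \<le> 2 ^ m"
    unfolding k by (simp only: of_int_le_numeral_power_cancel_iff)
  then have "k \<le> 2 ^ m"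
    by simp
  moreover have "real k - 1 \<le> 2 ^ m * h"
    unfolding k using assms ceiling_correct[of "2 ^ m * h"] by (auto simp: max_def)
  moreover have "2 ^ m * h \<le> real k"
    unfolding k using ceiling_correct[of "2 ^ m * h"] by (auto simp: max_def)
  moreover have "1 \<le> k"
    unfolding k_def by simp
  ultimately show ?thesis
    by (intro that[of k]) (auto simp: field_simps)
qed

text \<open>
  Since the weight and the nodes do not depend on \<open>u\<close>, bounds on \<open>X l\<close> and \<open>X r\<close> that are uniform over
  the nodes pass to the polygon, for values and for increments in \<open>u\<close> alike.
\<close>

lemma dyadic_polygon_convex_combination:
  fixes h :: real
  assumes "h \<in> {0..1}"
  obtains l r c where "l \<in> {0..1}" "r \<in> {0..1}" "c \<in> {0..1}"
    "\<bar>l - h\<bar> \<le> (1 / 2) ^ m" "\<bar>r - h\<bar> \<le> (1 / 2) ^ m"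
    "\<And>u. dyadic_polygon m X h u = (1 - c) * X l u + c * X r u"
proof -
  obtain k where k: "1 \<le> k" "k \<le> 2 ^ m" "(real k - 1) / 2 ^ m \<le> h" "h \<le> real k / 2 ^ m"
    using dyadic_cell[OF assms] .
  define l r where "l = (real k - 1) / 2 ^ m" and "r = real k / 2 ^ m"
  have lr: "r - l = (1 / 2) ^ m"
    by (simp add: l_def r_def field_simps)
  have "0 \<le> l" "r \<le> 1"
    using k(1,2) by (simp_all add: l_def r_def)
  moreover have "l \<le> h" "h \<le> r"
    using k(3,4) by (simp_all add: l_def r_def)
  moreover have "2 ^ m * (h - l) \<le> 2 ^ m * (r - l)"
    using \<open>h \<le> r\<close> by (intro mult_left_mono) auto
  then have "2 ^ m * (h - l) \<le> 1"
    unfolding lr by (simp add: power_divide)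
  moreover have "dyadic_polygon m X h u = (1 - 2 ^ m * (h - l)) * X l u + (2 ^ m * (h - l)) * X r u" for u
    unfolding dyadic_polygon_eq[OF k(1,3,4)] l_def[symmetric] r_def[symmetric]
    by (simp add: algebra_simps)
  ultimately show ?thesis
    using lr by (intro that[of l r "2 ^ m * (h - l)"]) simp_all
qed

lemma convex_combination_abs_le:
  fixes x y c K :: real
  assumes "c \<in> {0..1}" "\<bar>x\<bar> \<le> K" "\<bar>y\<bar> \<le> K"
  shows "\<bar>(1 - c) * x + c * y\<bar> \<le> K"
proof -
  have "\<bar>(1 - c) * x + c * y\<bar> \<le> (1 - c) * \<bar>x\<bar> + c * \<bar>y\<bar>"
    using assms(1) by (intro order_trans[OF abs_triangle_ineq]) (simp add: abs_mult)
  also have "\<dots> \<le> (1 - c) * K + c * K"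
    using assms by (intro add_mono mult_left_mono) auto
  finally show ?thesis
    by (simp add: algebra_simps)
qed

lemma dyadic_polygon_approx:
  assumes h: "h \<in> {0..1}" and "0 \<le> \<alpha>" "0 \<le> C"
    and X: "\<And>h k. h \<in> {0..1} \<Longrightarrow> k \<in> {0..1} \<Longrightarrow> \<bar>X h u - X k u\<bar> \<le> C * \<bar>h - k\<bar> powr \<alpha>"
  shows "\<bar>dyadic_polygon m X h u - X h u\<bar> \<le> C * ((1 / 2) ^ m) powr \<alpha>"
proof -
  obtain l r c where lr: "l \<in> {0..1}" "r \<in> {0..1}" "c \<in> {0..1}"
    "\<bar>l - h\<bar> \<le> (1 / 2) ^ m" "\<bar>r - h\<bar> \<le> (1 / 2) ^ m"
    and eq: "dyadic_polygon m X h u = (1 - c) * X l u + c * X r u"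
    using dyadic_polygon_convex_combination[OF h, of m X] by metis
  have le: "\<bar>X s u - X h u\<bar> \<le> C * ((1 / 2) ^ m) powr \<alpha>" if "s \<in> {0..1}" "\<bar>s - h\<bar> \<le> (1 / 2) ^ m" for s
    using that h assms(2,3) by (intro order_trans[OF X] mult_left_mono powr_mono2) auto
  have "dyadic_polygon m X h u - X h u = (1 - c) * (X l u - X h u) + c * (X r u - X h u)"
    unfolding eq by (simp add: algebra_simps)
  then show ?thesis
    using convex_combination_abs_le[OF lr(3) le le] lr by simp
qed

text \<open>
  Inside a cell the polygon is affine, so its increment is the fraction \<open>c\<close> of the increment over
  the cell, and \<open>c \<le> c powr \<alpha>\<close> because \<open>c \<le> 1\<close> and \<open>\<alpha> \<le> 1\<close>.
\<close>

lemma dyadic_polygon_holder_in_cell: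
  fixes k :: nat
  assumes k: "1 \<le> k" "k \<le> 2 ^ m" and "0 \<le> \<alpha>" "\<alpha> \<le> 1" "0 \<le> C"
    and s: "(real k - 1) / 2 ^ m \<le> s" "s \<le> real k / 2 ^ m"
    and t: "(real k - 1) / 2 ^ m \<le> t" "t \<le> real k / 2 ^ m"
    and X: "\<And>h k. h \<in> {0..1} \<Longrightarrow> k \<in> {0..1} \<Longrightarrow> \<bar>X h u - X k u\<bar> \<le> C * \<bar>h - k\<bar> powr \<alpha>"
  shows "\<bar>dyadic_polygon m X s u - dyadic_polygon m X t u\<bar> \<le> C * \<bar>s - t\<bar> powr \<alpha>"
proof -
  let ?\<delta> = "(1 / 2 :: real) ^ m" and ?l = "(real k - 1) / 2 ^ m" and ?r = "real k / 2 ^ m"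
  have k_le: "real k \<le> 2 ^ m"
    using k(2) by simp
  have lr: "?r - ?l = ?\<delta>"
    by (simp add: field_simps)
  have "\<bar>X ?r u - X ?l u\<bar> \<le> C * ?\<delta> powr \<alpha>"
    using X[of ?r ?l] k(1) k_le lr by (simp add: field_simps)
  moreover define c where "c = \<bar>s - t\<bar> / ?\<delta>"
  moreover have "\<bar>s - t\<bar> \<le> ?\<delta>"
    using s t lr by linarith
  then have c: "0 \<le> c" "c \<le> 1"
    unfolding c_def by (auto simp: divide_le_eq)
  moreover have "dyadic_polygon m X s u - dyadic_polygon m X t u = 2 ^ m * (s - t) * (X ?r u - X ?l u)"
    unfolding dyadic_polygon_eq[OF k(1) s] dyadic_polygon_eq[OF k(1) t] by (simp add: algebra_simps)
  ultimately have "\<bar>dyadic_polygon m X s u - dyadic_polygon m X t u\<bar> \<le> c * (C * ?\<delta> powr \<alpha>)"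
    by (simp add: abs_mult power_divide mult.commute mult_left_mono)
  also have "\<dots> \<le> c powr \<alpha> * (C * ?\<delta> powr \<alpha>)"
    using powr_mono'[of \<alpha> 1 c] c assms(4,5) by (intro mult_right_mono) auto
  also have "\<dots> = C * (c * ?\<delta>) powr \<alpha>"
    by (simp add: powr_mult)
  also have "c * ?\<delta> = \<bar>s - t\<bar>"
    by (simp add: c_def)
  finally show ?thesis .
qed

text \<open>
  If \<open>h\<close> and \<open>k\<close> are at least a mesh apart, the uniform approximation bound at both points suffices.
  Otherwise they lie in one cell or in two adjacent ones, and the Hoelder bound within cells applies,
  in the latter case by way of the common node.
\<close>

lemma dyadic_polygon_error_increment:
  assumes h: "h \<in> {0..1}" and k: "k \<in> {0..1}" and "0 \<le> \<alpha>" "\<alpha> \<le> 1" "0 \<le> C"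
    and X: "\<And>h k. h \<in> {0..1} \<Longrightarrow> k \<in> {0..1} \<Longrightarrow> \<bar>X h u - X k u\<bar> \<le> C * \<bar>h - k\<bar> powr \<alpha>"
  shows "\<bar>(dyadic_polygon m X h u - X h u) - (dyadic_polygon m X k u - X k u)\<bar>
    \<le> 3 * C * min \<bar>h - k\<bar> ((1 / 2) ^ m) powr \<alpha>"
  using h k
proof (induction h k rule: linorder_wlog)
  case (sym h k)
  then show ?case
    by (simp add: abs_minus_commute)
next
  case (le h k)
  let ?\<delta> = "(1 / 2 :: real) ^ m" and ?P = "\<lambda>h. dyadic_polygon m X h u"
  show ?case
  proof (cases "?\<delta> \<le> k - h")
    case True
    have "0 \<le> C * ?\<delta> powr \<alpha>"
      using \<open>0 \<le> C\<close> by simp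
    then show ?thesis
      using dyadic_polygon_approx[of h \<alpha> C X u m, OF _ _ _ X] dyadic_polygon_approx[of k \<alpha> C X u m, OF _ _ _ X]
        le assms(3,5) True by simp
  next
    case False
    obtain i where i: "1 \<le> i" "i \<le> 2 ^ m" "(real i - 1) / 2 ^ m \<le> h" "h \<le> real i / 2 ^ m"
      using dyadic_cell le(2) by blast
    have mono: "C * x powr \<alpha> \<le> C * (k - h) powr \<alpha>" if "0 \<le> x" "x \<le> k - h" for x
      using that assms(3,5) by (intro mult_left_mono powr_mono2) auto
    have "\<bar>?P h - ?P k\<bar> \<le> 2 * C * (k - h) powr \<alpha>"
    proof (cases "k \<le> real i / 2 ^ m")
      case True
      then have "\<bar>?P h - ?P k\<bar> \<le> C * \<bar>h - k\<bar> powr \<alpha>"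
        using i le(1) assms(3-5) X by (intro dyadic_polygon_holder_in_cell[of i]) auto
      then show ?thesis
        using le(1) mult_nonneg_nonneg[OF \<open>0 \<le> C\<close>, of "(k - h) powr \<alpha>"] by simp
    next
      case beyond: False
      let ?r = "real i / 2 ^ m"
      have "k \<le> 1"
        using le(3) by simp
      then have "?r < 1"
        using beyond by linarith
      then have i': "Suc i \<le> 2 ^ m"
        by simp
      have next_node: "real (Suc i) / 2 ^ m = ?r + ?\<delta>"
        by (simp add: field_simps)
      have "k \<le> ?r + ?\<delta>"
        using False i(4) by linarith
      then have "k \<le> real (Suc i) / 2 ^ m" "(real i - 1) / 2 ^ m \<le> ?r"
        unfolding next_node by (assumption, simp add: divide_right_mono)
      then have "\<bar>?P h - ?P ?r\<bar> \<le> C * \<bar>h - ?r\<bar> powr \<alpha>" "\<bar>?P ?r - ?P k\<bar> \<le> C * \<bar>?r - k\<bar> powr \<alpha>"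
        using i i' beyond assms(3-5) X
        by (intro dyadic_polygon_holder_in_cell[of i] dyadic_polygon_holder_in_cell[of "Suc i"]; simp)+
      moreover have "C * \<bar>h - ?r\<bar> powr \<alpha> \<le> C * (k - h) powr \<alpha>" "C * \<bar>?r - k\<bar> powr \<alpha> \<le> C * (k - h) powr \<alpha>"
        using i(4) beyond by (auto intro!: mono)
      ultimately show ?thesis
        by linarith
    qed
    then show ?thesis
      using X[of h k] le False by (simp add: min_def)
  qed
qed

lemma dyadic_polygon_error_holder:
  assumes h: "h \<in> {0..1}" and X: "\<And>h. h \<in> {0..1} \<Longrightarrow> \<bar>X h u - X h v\<bar> \<le> K"
  shows "\<bar>(dyadic_polygon m X h u - X h u) - (dyadic_polygon m X h v - X h v)\<bar> \<le> 2 * K"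
proof -
  obtain l r c where lr: "l \<in> {0..1}" "r \<in> {0..1}" "c \<in> {0..1}"
    and eq: "\<And>w. dyadic_polygon m X h w = (1 - c) * X l w + c * X r w"
    using dyadic_polygon_convex_combination[OF h, of m X] by metis
  have "dyadic_polygon m X h u - dyadic_polygon m X h v
      = (1 - c) * (X l u - X l v) + c * (X r u - X r v)"
    unfolding eq by (simp add: algebra_simps)
  then have "\<bar>dyadic_polygon m X h u - dyadic_polygon m X h v\<bar> \<le> K"
    using convex_combination_abs_le[OF lr(3) X[OF lr(1)] X[OF lr(2)]] by simp
  then show ?thesis
    using X[OF h] by linarith
qed

section \<open>The frame process\<close>

text \<open>
  The deterministic core. A mixed increment \<open>(X h u - X k u) - (X h v - X k v)\<close> is estimated by \<open>2 C\<close> as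
  the sum of two increments in \<open>u\<close>; for the polygon error the factor doubles once more, hence \<open>4 C\<close>.
\<close>

theorem variation_var_norm_holder_sheet:
  fixes X :: "real \<Rightarrow> real \<Rightarrow> real"
  assumes "0 < p" "0 < q" "\<alpha> \<le> 1" "1 / p + 1 / q < \<alpha>" "0 \<le> C"
    and X1: "\<And>h k u. h \<in> {0..1} \<Longrightarrow> k \<in> {0..1} \<Longrightarrow> u \<in> {0..1} \<Longrightarrow>
      \<bar>X h u - X k u\<bar> \<le> C * \<bar>h - k\<bar> powr \<alpha>"
    and X2: "\<And>h u v. h \<in> {0..1} \<Longrightarrow> u \<in> {0..1} \<Longrightarrow> v \<in> {0..1} \<Longrightarrow>
      \<bar>X h u - X h v\<bar> \<le> C * \<bar>u - v\<bar> powr \<alpha>"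
  shows "variation (var_norm p 0 1) q 0 1 X < \<infinity>"
    and "(\<lambda>m. variation (var_norm p 0 1) q 0 1 (\<lambda>h. dyadic_polygon m X h - X h)) \<longlonglongrightarrow> 0"
proof -
  have "0 < 1 / p" "0 < 1 / q"
    using assms(1,2) by simp_all
  then have "1 / p \<le> \<alpha>" "1 / q \<le> \<alpha> - 1 / p" "0 < \<alpha>"
    using assms(4) by linarith+
  then have \<alpha>: "1 \<le> \<alpha> * p" "1 \<le> (\<alpha> - 1 / p) * q" "0 < \<alpha>"
    using assms(1,2) by (simp_all only: pos_divide_le_eq)
  have "variation (var_norm p 0 1) q 0 1 X \<le> ennreal (3 * (2 * C) * 1 powr (\<alpha> - 1 / p - 1 / q))"
  proof (rule variation_var_norm_le)
    show "\<bar>X h u - X k u\<bar> \<le> 2 * C * min \<bar>h - k\<bar> 1 powr \<alpha>"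
      if "h \<in> {0..1}" "k \<in> {0..1}" "u \<in> {0..1}" for h k u
    proof -
      have "min \<bar>h - k\<bar> 1 = \<bar>h - k\<bar>"
        using that by auto
      then show ?thesis
        using X1[OF that] mult_nonneg_nonneg[OF \<open>0 \<le> C\<close>, of "\<bar>h - k\<bar> powr \<alpha>"] by simp
    qed
    show "\<bar>(X h u - X k u) - (X h v - X k v)\<bar> \<le> 2 * C * \<bar>u - v\<bar> powr \<alpha>"
      if "h \<in> {0..1}" "k \<in> {0..1}" "u \<in> {0..1}" "v \<in> {0..1}" for h k u v
      using X2[of h u v] X2[of k u v] that by linarith
  qed (use assms \<alpha> in auto)
  then show "variation (var_norm p 0 1) q 0 1 X < \<infinity>"
    using ennreal_less_top order_le_less_trans by fastforce
  define \<rho> where "\<rho> = (1 / 2 :: real) powr (\<alpha> - 1 / p - 1 / q)"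
  have \<rho>: "0 < \<rho>" "\<rho> < 1"
    using powr_less_mono2[of "\<alpha> - 1 / p - 1 / q" "1/2" 1] assms(4) unfolding \<rho>_def by auto
  have le: "variation (var_norm p 0 1) q 0 1 (\<lambda>h. dyadic_polygon m X h - X h) \<le> ennreal (12 * C * \<rho> ^ m)"
    for m
  proof -
    have "variation (var_norm p 0 1) q 0 1 (\<lambda>h. dyadic_polygon m X h - X h)
        \<le> ennreal (3 * (4 * C) * ((1 / 2) ^ m) powr (\<alpha> - 1 / p - 1 / q))"
    proof (rule variation_var_norm_le)
      show "\<bar>(dyadic_polygon m X h - X h) u - (dyadic_polygon m X k - X k) u\<bar>
          \<le> 4 * C * min \<bar>h - k\<bar> ((1 / 2) ^ m) powr \<alpha>"
        if "h \<in> {0..1}" "k \<in> {0..1}" "u \<in> {0..1}" for h k u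
        using dyadic_polygon_error_increment[of h k \<alpha> C X u m] X1 that assms(3,5) \<alpha>(3)
          mult_nonneg_nonneg[OF \<open>0 \<le> C\<close>, of "min \<bar>h - k\<bar> ((1 / 2) ^ m) powr \<alpha>"] by simp
      show "\<bar>((dyadic_polygon m X h - X h) u - (dyadic_polygon m X k - X k) u)
          - ((dyadic_polygon m X h - X h) v - (dyadic_polygon m X k - X k) v)\<bar>
          \<le> 4 * C * \<bar>u - v\<bar> powr \<alpha>"
        if "h \<in> {0..1}" "k \<in> {0..1}" "u \<in> {0..1}" "v \<in> {0..1}" for h k u v
        using dyadic_polygon_error_holder[of h X u v "C * \<bar>u - v\<bar> powr \<alpha>" m]
          dyadic_polygon_error_holder[of k X u v "C * \<bar>u - v\<bar> powr \<alpha>" m] X2 that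
        by simp
    qed (use assms \<alpha> in \<open>auto simp: power_le_one\<close>)
    then show ?thesis
      by (simp add: half_power_powr \<rho>_def)
  qed
  have "(\<lambda>m. \<rho> ^ m) \<longlonglongrightarrow> 0"
    using \<rho> by (intro LIMSEQ_power_zero) simp
  then have "(\<lambda>m. ennreal (12 * C * \<rho> ^ m)) \<longlonglongrightarrow> ennreal (12 * C * 0)"
    by (rule tendsto_ennrealI[OF tendsto_mult_left])
  then have lim: "(\<lambda>m. ennreal (12 * C * \<rho> ^ m)) \<longlonglongrightarrow> 0"
    by simp
  show "(\<lambda>m. variation (var_norm p 0 1) q 0 1 (\<lambda>h. dyadic_polygon m X h - X h)) \<longlonglongrightarrow> 0"
    by (rule tendsto_sandwich[OF always_eventually always_eventually tendsto_const lim]) (auto intro: le)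
qed

text \<open>
  Convergence in the \<open>p\<close>-variation norm thus implies pointwise convergence, which is how the continuity of
  the modification is used.
\<close>

lemma abs_le_var_norm:
  assumes "f \<in> cont_var_paths p a b" "g \<in> cont_var_paths p a b" "u \<in> {a..b}"
  shows "\<bar>f u - g u\<bar> \<le> var_norm p a b (f - g)"
proof -
  have "continuous_on {a..b} (\<lambda>u. \<bar>f u - g u\<bar>)"
    using assms by (auto simp: cont_var_paths_def cont_paths_def intro!: continuous_intros)
  then have "bdd_above ((\<lambda>u. \<bar>f u - g u\<bar>) ` {a..b})"
    by (intro bounded_imp_bdd_above compact_imp_bounded compact_continuous_image) auto
  then have "\<bar>f u - g u\<bar> \<le> sup_norm a b (f - g)"
    unfolding sup_norm_def using assms(3) by (auto intro: cSUP_upper)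
  then show ?thesis
    unfolding var_norm_def by (simp add: add_increasing)
qed

lemma countable_dense_unit_interval:
  obtains Q :: "real set" where "countable Q" "Q \<subseteq> {0..1}" "closure Q = {0..1}"
proof
  let ?Q = "{0..1} \<inter> (\<Union>k m. {of_nat m / 2 ^ k}) :: real set"
  show "countable ?Q"
    by (intro countable_Int2 countable_UN) auto
  show "closure ?Q = {0..1}"
    by (subst closure_dyadic_rationals_in_convex_set_pos_1) (auto simp: interior_atLeastAtMost_real)
qed auto

text \<open>
  For fixed \<open>u\<close>, both \<open>h \<longmapsto> S h f u\<close> and \<open>h \<longmapsto> f (h - 1 + u)\<close> are continuous, and outside one null set they
  agree for all \<open>h\<close> in a countable dense set.
\<close>

lemma continuous_modification_eq_frame:
  assumes mod: "continuous_modification p M (brownian_frame p) S"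
    and paths: "AE f in M. f \<in> cont_var_paths0 p (-1) 1"
  shows "AE f in M. \<forall>h\<in>{0..1}. S h f = frame h f"
proof -
  obtain Q :: "real set" where Q: "countable Q" "Q \<subseteq> {0..1}" "closure Q = {0..1}"
    using countable_dense_unit_interval .
  have "AE f in M. \<forall>h\<in>Q. S h f = brownian_frame p h f"
  proof (rule AE_ball_countable'[OF _ Q(1)])
    show "AE f in M. S h f = brownian_frame p h f" if "h \<in> Q" for h
      using mod Q(2) that unfolding continuous_modification_def by blast
  qed
  then show ?thesis
    using paths AE_space
  proof (eventually_elim, intro ballI)
    case (elim f)
    fix h :: real
    assume h: "h \<in> {0..1}"
    have S_in: "S k f \<in> cont_var_paths p 0 1" if "k \<in> {0..1}" for k
      using mod elim(3) that by (auto simp: continuous_modification_def)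
    have f: "continuous_on {-1..1} f"
      using elim(2) by (auto simp: cont_var_paths0_def cont_var_paths_def cont_paths_def)
    have "S h f u = frame h f u" for u
    proof (cases "u \<in> {0..1}")
      case u: True
      have "continuous_on {0..1} (\<lambda>k. S k f u)"
        unfolding continuous_on_def
      proof
        fix k :: real
        assume k: "k \<in> {0..1}"
        have "((\<lambda>l. var_norm p 0 1 (S l f - S k f)) \<longlongrightarrow> 0) (at k within {0..1})"
          using mod elim(3) k by (auto simp: continuous_modification_def)
        then have "((\<lambda>l. S l f u - S k f u) \<longlongrightarrow> 0) (at k within {0..1})"
          by (rule Lim_null_comparison[rotated])
            (use abs_le_var_norm[OF S_in S_in u] k in \<open>auto simp: eventually_at_filter\<close>)
        then show "((\<lambda>l. S l f u) \<longlongrightarrow> S k f u) (at k within {0..1})"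
          by (simp add: LIM_zero_iff)
      qed
      moreover have "continuous_on {0..1} (\<lambda>k. f (k - 1 + u))"
        using u by (intro continuous_on_compose2[OF f] continuous_intros) auto
      ultimately have "continuous_on (closure Q) (\<lambda>k. S k f u - f (k - 1 + u))"
        unfolding Q(3) by (rule continuous_on_diff)
      moreover have "S k f u - f (k - 1 + u) = 0" if "k \<in> Q" for k
        using elim(1,2) that u by (auto simp: brownian_frame_def frame_def)
      ultimately have "S h f u - f (h - 1 + u) = 0"
        using continuous_constant_on_closure[of Q "\<lambda>k. S k f u - f (k - 1 + u)" 0 h] h Q(3) by blast
      then show ?thesis
        using u by (simp add: frame_def)
    next
      case False
      then show ?thesis
        using S_in[OF h] by (auto simp: frame_def cont_var_paths_def cont_paths_def extensional_def)
    qed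
    then show "S h f = frame h f" ..
  qed
qed

lemma variation_holder_path:
  fixes f :: "real \<Rightarrow> real"
  assumes "0 < p" "1 \<le> \<alpha> * p" "0 \<le> C" "a < b"
    and f: "\<And>s t. s \<in> {a..b} \<Longrightarrow> t \<in> {a..b} \<Longrightarrow> \<bar>f s - f t\<bar> \<le> C * \<bar>s - t\<bar> powr \<alpha>"
  shows "variation abs p a b f < \<infinity>"
proof -
  have "variation abs p a b f \<le> ennreal (C * (b - a) powr (\<alpha> - 1 / p) * (b - a) powr (1 / p))"
  proof (rule variation_le_if_holder)
    show "\<bar>f t - f s\<bar> \<le> C * min (t - s) (b - a) powr \<alpha>" if "a \<le> s" "s < t" "t \<le> b" for s t
      using f[of t s] that by (simp add: min_def)
  qed (use assms in auto)
  then show ?thesis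
    using ennreal_less_top order_le_less_trans by fastforce
qed

lemma wiener_AE_completion:
  assumes "wiener_measure a b W" "AE f in W. P f"
  shows "AE f in completion W. f \<in> cont_paths0 a b \<and> P f"
proof -
  have "space W = cont_paths0 a b"
    using sets_eq_imp_space_eq[of W "borel_cont_paths0 a b"] assms(1)
    by (simp add: wiener_measure_def borel_cont_paths0_def space_measure_of_conv)
  then show ?thesis
    using assms(2) AE_space[of W] by (intro AE_completion) auto
qed

theorem corollary29:
  fixes p q :: real
    and W :: "(real \<Rightarrow> real) measure"
    and S :: "real \<Rightarrow> (real \<Rightarrow> real) \<Rightarrow> real \<Rightarrow> real"
  assumes "p > 2" and "q > 2" and "q > 2 * p / (p - 2)"
    and "wiener_measure (-1) 1 W"
    and "continuous_modification p (completion W) (brownian_frame p) S"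
  shows "(AE f in completion W. variation (var_norm p 0 1) q 0 1 (\<lambda>h. S h f) < \<infinity>) \<and>
    (AE f in completion W.
      (\<lambda>m. variation (var_norm p 0 1) q 0 1
             (\<lambda>h. dyadic_polygon m (\<lambda>h. S h f) h - S h f)) \<longlonglongrightarrow> 0)"
proof -
  have "1 / p + 1 / q < 1 / 2"
    using assms(1-3) by (simp add: field_simps)
  then obtain \<alpha> where \<alpha>: "1 / p + 1 / q < \<alpha>" "\<alpha> < 1 / 2"
    using dense by blast
  have pos: "0 < 1 / p" "0 < 1 / q"
    using assms(1,2) by auto
  then have "0 < \<alpha>" "1 / p \<le> \<alpha>"
    using \<alpha>(1) by linarith+
  then have "1 \<le> \<alpha> * p"
    using assms(1) by (simp add: field_simps)
  have "AE f in W. \<exists>C\<ge>0. \<forall>s\<in>{-1..1}. \<forall>t\<in>{-1..1}. \<bar>f s - f t\<bar> \<le> C * \<bar>s - t\<bar> powr \<alpha>"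
    using brownian_motion_on_holder[of W "-1" 1 "\<lambda>t f. f t" \<alpha>] \<open>0 < \<alpha>\<close> \<alpha>(2) assms(4)
    by (simp add: wiener_measure_def)
  note holder = wiener_AE_completion[OF assms(4) this]
  then have "AE f in completion W. f \<in> cont_var_paths0 p (-1) 1"
  proof eventually_elim
    case (elim f)
    then have "variation abs p (-1) 1 f < \<infinity>"
      using variation_holder_path[of p \<alpha> _ "-1" 1 f] \<open>1 \<le> \<alpha> * p\<close> assms(1) by force
    then show ?case
      using elim by (simp add: cont_var_paths0_def cont_var_paths_def cont_paths0_def)
  qed
  note frame = continuous_modification_eq_frame[OF assms(5) this]
  have "AE f in completion W. variation (var_norm p 0 1) q 0 1 (\<lambda>h. S h f) < \<infinity> \<and>
      (\<lambda>m. variation (var_norm p 0 1) q 0 1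
             (\<lambda>h. dyadic_polygon m (\<lambda>h. S h f) h - S h f)) \<longlonglongrightarrow> 0"
    using holder frame
  proof eventually_elim
    case (elim f)
    then obtain C where C: "0 \<le> C"
      "\<And>s t. s \<in> {-1..1} \<Longrightarrow> t \<in> {-1..1} \<Longrightarrow> \<bar>f s - f t\<bar> \<le> C * \<bar>s - t\<bar> powr \<alpha>"
      by blast
    have S: "S h f u = f (h - 1 + u)" if "h \<in> {0..1}" "u \<in> {0..1}" for h u
      using elim(2) that by (simp add: frame_def)
    have "\<bar>S h f u - S k f u\<bar> \<le> C * \<bar>h - k\<bar> powr \<alpha>"
      if "h \<in> {0..1}" "k \<in> {0..1}" "u \<in> {0..1}" for h k u
      using C(2)[of "h - 1 + u" "k - 1 + u"] that by (simp add: S)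
    moreover have "\<bar>S h f u - S h f v\<bar> \<le> C * \<bar>u - v\<bar> powr \<alpha>"
      if "h \<in> {0..1}" "u \<in> {0..1}" "v \<in> {0..1}" for h u v
      using C(2)[of "h - 1 + u" "h - 1 + v"] that by (simp add: S)
    ultimately show ?case
      using variation_var_norm_holder_sheet[of p q \<alpha> C "\<lambda>h. S h f"] assms(1,2) \<alpha> C(1) by simp
  qed
  then show ?thesis
    by (simp add: AE_conj_iff)
qed

end
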